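(* Assume that $\Xi$ is bounded and set $I=1$. Choose $\epsilon\ge0$ and $\hat\xi_1\in\Xi$ such that $d(\xi,\hat\xi_1)=\|\xi-\hat\xi_1\|_2\le\epsilon$ for all $\xi\in\Xi$. Let (RO) denote the two-stage robust optimization problem of minimizing $c^\top x+\max_{\xi\in\Xi}Z(x,\xi)$ over $x\in\mathcal X$. For $\delta\ge0$ consider the copositive program $$(\mathrm{CP}_\delta)\qquad \begin{array}{ll} \text{minimize} & \displaystyle c^\top x+\epsilon^2\lambda+s+\mathfrak q^\top\psi-\lambda\|\hat\xi_1\|_2^2+\sum_{j\in[N_2+J]}\phi_{j}\mathfrak q_j^2\\ \text{subject to} & x\in\mathcal X,\ \lambda\in\mathbb R_+,\ s\in\mathbb R,\ \psi,\phi\in\mathbb R^{N_2+J},\\ &\begin{bmatrix}\lambda\mathbb I+\mathcal Q^\top\mathrm{diag}(\phi)\mathcal Q & -\frac12\mathcal T(x)^\top-\mathcal Q^\top\mathrm{diag}(\phi)\mathcal W^\top & -\lambda\hat\xi_1-\frac12\mathcal Q^\top\psi\\ -\frac12\mathcal T(x)-\mathcal W\mathrm{diag}(\phi)\mathcal Q & \mathcal W\mathrm{diag}(\phi)\mathcal W^\top+\delta\mathbb I & \frac12(\mathcal W\psi-\mathfrak h(x))\\ (-\lambda\hat\xi_1-\frac12\mathcal Q^\top\psi)^\top & \frac12(\mathcal W\psi-\mathfrak h(x))^\top & s\end{bmatrix}\succeq_{\mathcal C}0. \end{array}$$ Then the following statements hold. (i) If $\delta=0$ and (RO) has complete recourse,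 then $(\mathrm{CP}_\delta)$ is equivalent to (RO). (ii) If $\delta=0$ and (RO) fails to have complete recourse, then $(\mathrm{CP}_\delta)$ provides an upper bound on (RO). (iii) If $\delta>0$, then $(\mathrm{CP}_\delta)$ provides a lower bound on (RO). (iv) If $\mathcal X$ is compact, then the optimal value of $(\mathrm{CP}_\delta)$ converges to that of (RO) as $\delta\downarrow0$. Moreover, every cluster point $x^\star$ of a sequence $\{x^\star_\delta\}_{\delta\downarrow0}$ of minimizers for $(\mathrm{CP}_\delta)$ is a minimizer for (RO).
   Context: Notation: $[n]=\{1,\dots,n\}$; $\mathbb I$ is an identity matrix; $\mathcal C$ is the cone of copositive matrices (symmetric $A$ with $\xi^\top A\xi\ge0$ for all $\xi\ge0$), and $A\succeq_{\mathcal C}0$ means $A\in\mathcal C$. Problem data: $c\in\mathbb R^{N_1}$, $\mathcal X\subseteq\mathbb R^{N_1}$, $Q\in\mathbb R^{N_2\times K}$, $q\in\mathbb R^{N_2}$, $W\in\mathbb R^{M\times N_2}$, and affine functions $T:\mathbb R^{N_1}\to\mathbb R^{M\times K}$, $h:\mathbb R^{N_1}\to\mathbb R^M$. The uncertainty set is a nonempty polyhedron $\Xi=\{\xi\in\mathbb R_+^K: S\xi\le t\}$ with $S\in\mathbb R^{J\times K}$, $t\in\mathbb R^J$. The recourse function is $$Z(x,\xi)=\inf\{(Q\xi+q)^\top y:\ y\in\mathbb R^{N_2},\ T(x)\xi+h(x)\le Wy\}.$$ Complete recourse: there exists $y^+\in\mathbb R^{N_2}$ with $Wy^+>0$ componentwise.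 Sufficiently expensive recourse (standing assumption): for every $\xi\in\Xi$ there exists $p\in\mathbb R_+^M$ with $Q\xi+q=W^\top p$. Extended parameters: $$\mathcal Q=\begin{bmatrix}Q\\S\end{bmatrix},\quad \mathfrak q=\begin{bmatrix}q\\-t\end{bmatrix},\quad\mathcal T(x)=\begin{bmatrix}T(x)\\0\end{bmatrix},\quad\mathfrak h(x)=\begin{bmatrix}h(x)\\0\end{bmatrix},\quad\mathcal W=\begin{bmatrix}W&0\\0&-\mathbb I\end{bmatrix},$$ with $\mathcal Q\in\mathbb R^{(N_2+J)\times K}$, $\mathfrak q\in\mathbb R^{N_2+J}$, $\mathcal T(x)\in\mathbb R^{(M+J)\times K}$, $\mathfrak h(x)\in\mathbb R^{M+J}$, $\mathcal W\in\mathbb R^{(M+J)\times(N_2+J)}$. Conventions: optimal values (and $\max_{\xi\in\Xi}Z(x,\xi)$, read as a supremum) lie in $[-\infty,\infty]$. "Equivalent" means that for every $x\in\mathcal X$ the infimum of the objective of $(\mathrm{CP}_\delta)$ over all variables other than $x$ equals $c^\top x+\max_{\xi\in\Xi}Z(x,\xi)$ (so the optimal values coincide). "Upper (lower) bound" refers to the optimal values. A minimizer for $(\mathrm{CP}_\delta)$ in (iv) means a point $x_\delta^\star\in\mathcal X$ minimizing over $\mathcal X$ the function of $x$ obtained from the objective of $(\mathrm{CP}_\delta)$ by taking the infimum over all other variables. *)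

theory Defs
  imports "HOL-Analysis.Analysis"
begin

definition hcat :: "'a^'n^'m \<Rightarrow> 'a^'p^'m \<Rightarrow> 'a^('n + 'p)^'m"
  where "hcat A B = (\<chi> i j. case j of Inl l \<Rightarrow> A $ i $ l | Inr r \<Rightarrow> B $ i $ r)"

text \<open>Vertical concatenation. Matrices are vectors of rows, so this covers both the stacking of
  two vectors and the stacking of two matrices of equal width.\<close>

definition vcat :: "'a^'n \<Rightarrow> 'a^'p \<Rightarrow> 'a^('n + 'p)"
  where "vcat u v = (\<chi> i. case i of Inl l \<Rightarrow> u $ l | Inr r \<Rightarrow> v $ r)"

definition diag :: "'a::zero^'n \<Rightarrow> 'a^'n^'n"
  where "diag v = (\<chi> i j. if i = j then v $ i else 0)"

definition copositive :: "real^'n^'n \<Rightarrow> bool"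
  where "copositive A \<longleftrightarrow> transpose A = A \<and> (\<forall>\<xi>. 0 \<le> \<xi> \<longrightarrow> 0 \<le> \<xi> \<bullet> (A *v \<xi>))"

definition affine_map :: "('a::real_vector \<Rightarrow> 'b::real_vector) \<Rightarrow> bool"
  where "affine_map f \<longleftrightarrow> (\<exists>L b. linear L \<and> (\<forall>x. f x = L x + b))"

text \<open>The order on vectors is componentwise.\<close>

definition uncertainty_set :: "real^'k^'j \<Rightarrow> real^'j \<Rightarrow> (real^'k) set"
  where "uncertainty_set S t = {\<xi>. 0 \<le> \<xi> \<and> S *v \<xi> \<le> t}"

definition recourse ::
    "real^'k^'n2 \<Rightarrow> real^'n2 \<Rightarrow> ('x \<Rightarrow> real^'k^'m) \<Rightarrow> ('x \<Rightarrow> real^'m) \<Rightarrow> real^'n2^'m \<Rightarrow>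
     'x \<Rightarrow> real^'k \<Rightarrow> ereal"
  where "recourse Q q T h W x \<xi> =
    (INF y \<in> {y. T x *v \<xi> + h x \<le> W *v y}. ereal ((Q *v \<xi> + q) \<bullet> y))"

text \<open>The strict order on vectors is not componentwise, hence the explicit quantifier.\<close>

definition complete_recourse :: "real^'n2^'m \<Rightarrow> bool"
  where "complete_recourse W \<longleftrightarrow> (\<exists>y. \<forall>i. 0 < (W *v y) $ i)"

definition sufficiently_expensive_recourse ::
    "real^'k^'n2 \<Rightarrow> real^'n2 \<Rightarrow> real^'n2^'m \<Rightarrow> (real^'k) set \<Rightarrow> bool"
  where "sufficiently_expensive_recourse Q q W \<Xi> \<longleftrightarrow>
    (\<forall>\<xi>\<in>\<Xi>. \<exists>p. 0 \<le> p \<and> Q *v \<xi> + q = transpose W *v p)"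

definition ro_objective ::
    "'x::real_inner \<Rightarrow> real^'k^'n2 \<Rightarrow> real^'n2 \<Rightarrow> ('x \<Rightarrow> real^'k^'m) \<Rightarrow> ('x \<Rightarrow> real^'m) \<Rightarrow>
     real^'n2^'m \<Rightarrow> (real^'k) set \<Rightarrow> 'x \<Rightarrow> ereal"
  where "ro_objective c Q q T h W \<Xi> x = ereal (c \<bullet> x) + (SUP \<xi>\<in>\<Xi>. recourse Q q T h W x \<xi>)"

definition ext_Q :: "real^'k^'n2 \<Rightarrow> real^'k^'j \<Rightarrow> real^'k^('n2 + 'j)"
  where "ext_Q Q S = vcat Q S"

definition ext_q :: "real^'n2 \<Rightarrow> real^'j \<Rightarrow> real^('n2 + 'j)"
  where "ext_q q t = vcat q (- t)"

definition ext_T :: "real^'k^'m \<Rightarrow> real^'k^('m + 'j::finite)"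
  where "ext_T Tx = vcat Tx 0"

definition ext_h :: "real^'m \<Rightarrow> real^('m + 'j::finite)"
  where "ext_h hx = vcat hx 0"

definition ext_W :: "real^'n2^'m \<Rightarrow> real^('n2 + 'j::finite)^('m + 'j)"
  where "ext_W W = vcat (hcat W 0) (hcat 0 (- mat 1))"

text \<open>The arguments \<open>Q\<close>, \<open>Tx\<close>, \<open>hx\<close>, \<open>W\<close> of the following matrix are meant to be the extended
  parameters. Its last row and column are indexed by the one-element type \<open>1\<close>.\<close>

definition cp_matrix ::
    "real \<Rightarrow> real^'k \<Rightarrow> real^'k^'n \<Rightarrow> real^'k^'m \<Rightarrow> real^'m \<Rightarrow> real^'n^'m \<Rightarrow>
     real \<Rightarrow> real \<Rightarrow> real^'n \<Rightarrow> real^'n \<Rightarrow> real^('k + ('m + 1))^('k + ('m + 1))"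
  where "cp_matrix \<delta> \<xi>1 Q Tx hx W l s \<psi> \<phi> =
    (let u = - (l *\<^sub>R \<xi>1) - (1/2) *\<^sub>R (transpose Q *v \<psi>);
         v = (1/2) *\<^sub>R (W *v \<psi> - hx)
     in vcat
         (hcat (l *\<^sub>R mat 1 + transpose Q ** diag \<phi> ** Q)
           (hcat (- ((1/2) *\<^sub>R transpose Tx) - transpose Q ** diag \<phi> ** transpose W)
             (columnvector u)))
       (vcat
         (hcat (- ((1/2) *\<^sub>R Tx) - W ** diag \<phi> ** Q)
           (hcat (W ** diag \<phi> ** transpose W + \<delta> *\<^sub>R mat 1)
             (columnvector v)))
         (hcat (rowvector u) (hcat (rowvector v) (mat s)))))"

text \<open>The infimum of the objective of the copositive program over all variables other than \<open>x\<close>.\<close>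

definition cp_objective ::
    "real \<Rightarrow> real \<Rightarrow> real^'k \<Rightarrow> 'x::real_inner \<Rightarrow> real^'k^'n2 \<Rightarrow> real^'n2 \<Rightarrow> ('x \<Rightarrow> real^'k^'m) \<Rightarrow>
     ('x \<Rightarrow> real^'m) \<Rightarrow> real^'n2^'m \<Rightarrow> real^'k^'j \<Rightarrow> real^'j \<Rightarrow> 'x \<Rightarrow> ereal"
  where "cp_objective \<delta> \<epsilon> \<xi>1 c Q q T h W S t x =
    (INF (l, s, \<psi>, \<phi>) \<in>
        {(l, s, \<psi>, \<phi>). 0 \<le> l \<and>
          copositive (cp_matrix \<delta> \<xi>1 (ext_Q Q S) (ext_T (T x)) (ext_h (h x)) (ext_W W) l s \<psi> \<phi>)}.
      ereal (c \<bullet> x + \<epsilon>\<^sup>2 * l + s + ext_q q t \<bullet> \<psi> - l * (norm \<xi>1)\<^sup>2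
        + (\<Sum>j\<in>UNIV. \<phi> $ j * (ext_q q t $ j)\<^sup>2)))"

end

theory Submission
  imports Defs
begin

text \<open>By linear programming duality, the worst-case cost at \<open>x\<close> is the supremum of the bilinear
  function \<open>(T(x) \<xi> + h(x)) \<bullet> p\<close> over the polyhedron \<open>P\<close> of all \<open>\<xi>, p \<ge> 0\<close> with
  \<open>Q \<xi> + q = W\<^sup>T p\<close> (extended parameters throughout). Evaluating the copositive form at
  \<open>(\<xi>, p, 1)\<close> shows that the objective of the copositive program always dominates the supremum of
  the same function minus \<open>\<delta> |p|\<^sup>2\<close>. Equality holds when \<open>\<delta> > 0\<close> or the recourse is complete:
  already with \<open>\<lambda> = 0\<close>, a quadratic penalty for the equation defining \<open>P\<close> makes the form nonnegative
  on the compact set of unit vectors of the nonnegative orthant. Thus for \<open>\<delta> > 0\<close> the objective is a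
  supremum of functions continuous in \<open>x\<close> that increases to the robust one as \<open>\<delta>\<close> decreases to \<open>0\<close>,
  and a compactness argument gives the convergence.\<close>

section \<open>Block vectors and block matrices\<close>

lemma nonneg_inner: "0 \<le> x \<Longrightarrow> 0 \<le> y \<Longrightarrow> 0 \<le> x \<bullet> y" for x y :: "real^'n"
  by (auto simp: inner_vec_def less_eq_vec_def intro!: sum_nonneg)

lemma inner_transpose: "(transpose A *v x) \<bullet> y = x \<bullet> (A *v y)" for A :: "real^'n^'m"
  by (simp add: dot_lmul_matrix)

lemma sum_plus_type: "(\<Sum>i\<in>UNIV. f i) = (\<Sum>i\<in>UNIV. f (Inl i)) + (\<Sum>i\<in>UNIV. f (Inr i))"
  for f :: "'a::finite + 'b::finite \<Rightarrow> 'c::comm_monoid_add"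
  by (simp add: UNIV_Plus_UNIV[symmetric] sum.Plus del: UNIV_Plus_UNIV)

lemma vcat_nth [simp]: "vcat u v $ Inl i = u $ i" "vcat u v $ Inr j = v $ j"
  by (simp_all add: vcat_def)

lemma hcat_nth [simp]: "hcat A B $ k $ Inl i = A $ k $ i" "hcat A B $ k $ Inr j = B $ k $ j"
  by (simp_all add: hcat_def)

lemma vcat_cases: obtains u v where "z = vcat u v"
proof
  show "z = vcat (\<chi> i. z $ Inl i) (\<chi> j. z $ Inr j)"
    by (simp add: vec_eq_iff vcat_def split: sum.split)
qed

lemma vec_sum_eq_iff: "x = y \<longleftrightarrow> (\<forall>i. x $ Inl i = y $ Inl i) \<and> (\<forall>j. x $ Inr j = y $ Inr j)"
  by (simp add: vec_eq_iff split_sum_all)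

lemma vcat_add: "vcat u v + vcat u' v' = vcat (u + u') (v + v')"
  by (simp add: vec_sum_eq_iff)

lemma vcat_eq_iff: "vcat u v = vcat u' v' \<longleftrightarrow> u = u' \<and> v = v'"
  by (simp add: vec_sum_eq_iff) (simp add: vec_eq_iff)

lemma vec_sum_le_iff: "x \<le> y \<longleftrightarrow> (\<forall>i. x $ Inl i \<le> y $ Inl i) \<and> (\<forall>j. x $ Inr j \<le> y $ Inr j)"
  by (simp add: less_eq_vec_def split_sum_all)

lemma nonneg_vcat: "0 \<le> vcat u v \<longleftrightarrow> 0 \<le> u \<and> 0 \<le> v"
  by (simp add: vec_sum_le_iff) (simp add: less_eq_vec_def)

lemma inner_vcat: "vcat u v \<bullet> vcat x y = u \<bullet> x + v \<bullet> y"
  by (simp add: inner_vec_def sum_plus_type)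

lemma vcat_mult: "vcat A B *v x = vcat (A *v x) (B *v x)"
  by (simp add: vec_sum_eq_iff matrix_vector_mult_def)

lemma hcat_mult: "hcat A B *v vcat x y = A *v x + B *v y"
  by (simp add: vec_eq_iff matrix_vector_mult_def sum_plus_type)

lemma transpose_vcat: "transpose (vcat A B) = hcat (transpose A) (transpose B)"
  by (simp add: vec_eq_iff transpose_def vcat_def hcat_def split: sum.split)

lemma transpose_hcat: "transpose (hcat A B) = vcat (transpose A) (transpose B)"
  by (simp add: vec_eq_iff transpose_def vcat_def hcat_def split: sum.split)

lemma columnvector_mult: "columnvector u *v w = w $ 1 *\<^sub>R u" for u :: "real^'n" and w :: "real^1"
  by (simp add: vec_eq_iff columnvector_def matrix_vector_mult_def)

lemma rowvector_mult: "(rowvector u :: real^'n^1) *v x = vec (u \<bullet> x)"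
  by (simp add: vec_eq_iff rowvector_def matrix_vector_mult_def inner_vec_def)

lemma transpose_diag: "transpose (diag v) = diag v"
  by (simp add: vec_eq_iff transpose_def diag_def)

lemma diag_mult: "(diag v *v w) $ i = v $ i * w $ i" for v :: "real^'n"
  by (simp add: diag_def matrix_vector_mult_def if_distrib [of "\<lambda>a. a * _"] cong: if_cong)

lemma inner_diag: "u \<bullet> (diag v *v w) = (\<Sum>i\<in>UNIV. v $ i * u $ i * w $ i)" for v :: "real^'n"
  by (simp add: inner_vec_def diag_mult ac_simps)

lemma matrix_vector_mult_uminus_left: "(- A) *v x = - (A *v x)" for A :: "real^'n^'m"
  by (simp add: vec_eq_iff matrix_vector_mult_def sum_negf)

lemma transpose_0: "transpose 0 = (0 :: real^'n^'m)"
  by (simp add: vec_eq_iff transpose_def)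

lemma transpose_add: "transpose (A + B) = transpose A + transpose B" for A :: "real^'n^'m"
  by (simp add: vec_eq_iff transpose_def)

lemma transpose_diff: "transpose (A - B) = transpose A - transpose B" for A :: "real^'n^'m"
  by (simp add: vec_eq_iff transpose_def)

lemma transpose_uminus: "transpose (- A) = - transpose A" for A :: "real^'n^'m"
  by (simp add: vec_eq_iff transpose_def)

lemma hcat_vcat: "hcat (vcat A C) (vcat B D) = vcat (hcat A B) (hcat C D)"
  by (simp add: vec_eq_iff vcat_def hcat_def split: sum.split)

section \<open>Symmetry and quadratic form of the program's matrix\<close>

lemma transpose_cp_matrix:
  "transpose (cp_matrix \<delta> \<xi>1 Q Tx hx W l s \<psi> \<phi>) = cp_matrix \<delta> \<xi>1 Q Tx hx W l s \<psi> \<phi>"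
  unfolding cp_matrix_def Let_def transpose_vcat transpose_hcat hcat_vcat transpose_add transpose_diff
      transpose_uminus transpose_columnvector transpose_rowvector transpose_scalar transpose_mat
      matrix_transpose_mul transpose_diag transpose_transpose matrix_mul_assoc ..

text \<open>Here \<open>w \<xi> p\<close> is the residual of the homogeneous dual equation and
  \<open>\<tau>\<close> the homogenising coordinate. The \<open>\<phi>\<close> terms of the four
  upper left blocks complete to weighted squares of the entries of \<open>w\<close>, and
  \<open>\<psi>\<close> enters only through its pairing with \<open>w\<close>, so both act as
  multipliers for that equation.\<close>

lemma cp_matrix_quadratic_form:
  fixes Q :: "real^'k^'n" and W :: "real^'n^'m"
  defines "w \<equiv> \<lambda>\<xi> p. Q *v \<xi> - transpose W *v p"
  shows "vcat \<xi> (vcat p (vec \<tau>)) \<bullet> (cp_matrix \<delta> \<xi>1 Q Tx hx W l s \<psi> \<phi> *v vcat \<xi> (vcat p (vec \<tau>)))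
    = l * (\<xi> \<bullet> \<xi> - 2 * \<tau> * (\<xi>1 \<bullet> \<xi>)) + (\<Sum>j\<in>UNIV. \<phi> $ j * (w \<xi> p $ j)\<^sup>2) - \<tau> * (\<psi> \<bullet> w \<xi> p)
      - (Tx *v \<xi> + \<tau> *\<^sub>R hx) \<bullet> p + \<delta> * (p \<bullet> p) + s * \<tau>\<^sup>2"
proof -
  have w2: "(\<Sum>j\<in>UNIV. \<phi> $ j * (w \<xi> p $ j)\<^sup>2) = (Q *v \<xi>) \<bullet> (diag \<phi> *v (Q *v \<xi>))
      - (Q *v \<xi>) \<bullet> (diag \<phi> *v (transpose W *v p)) - (transpose W *v p) \<bullet> (diag \<phi> *v (Q *v \<xi>))
      + (transpose W *v p) \<bullet> (diag \<phi> *v (transpose W *v p))"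
    unfolding inner_diag sum_subtractf[symmetric] sum.distrib[symmetric]
    by (intro sum.cong) (auto simp: w_def power2_eq_square algebra_simps)
  have mult: "x \<bullet> (A ** diag \<phi> ** B *v y) = (transpose A *v x) \<bullet> (diag \<phi> *v (B *v y))"
    for A :: "real^'n^'a" and B :: "real^'b^'n" and x y
    by (simp only: matrix_vector_mul_assoc[symmetric] inner_transpose)
  have tr: "x \<bullet> (transpose A *v y) = y \<bullet> (A *v x)" for x y and A :: "real^'a^'b"
    by (metis inner_transpose inner_commute)
  have vec1: "(vec a :: real^1) \<bullet> vec b = a * b" "(mat s :: real^1^1) *v vec a = vec (s * a)" for a b
    by (simp_all add: inner_vec_def vec_eq_iff matrix_vector_mult_def mat_def)
  show ?thesis
    unfolding w_def w2[unfolded w_def]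
    by (simp only: cp_matrix_def Let_def vcat_mult hcat_mult inner_vcat columnvector_mult rowvector_mult
        matrix_vector_mult_add_rdistrib matrix_vector_mult_diff_rdistrib matrix_vector_mult_uminus_left
        inner_add_right inner_add_left inner_transpose
        inner_diff_right inner_diff_left inner_minus_right inner_minus_left mult tr
        scaleR_matrix_vector_assoc[symmetric] inner_scaleR_right inner_scaleR_left vec1 vec_component
        transpose_transpose matrix_vector_mul_lid)
      (simp add: inner_commute dot_lmul_matrix algebra_simps power2_eq_square del: transpose_matrix_vector)
qed

section \<open>Linear programming duality\<close>

lemma nonneg_axis: "0 \<le> axis i (1 :: real)"
  by (simp add: less_eq_vec_def axis_def)

text \<open>Pairing \<open>A *v y - b\<close> with \<open>p\<close> gives one inequality. For the
  other, a real \<open>v\<close> strictly between the two values puts \<open>(d, v)\<close> outside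
  a finitely generated, hence closed, cone, and a separating hyperplane yields a primal point of
  value below \<open>v\<close>. The dual feasible \<open>p0\<close> excludes a degenerate
  hyperplane; if the primal is infeasible, both sides are \<infinity>.\<close>

lemma lp_duality:
  fixes A :: "real^'n^'m"
  assumes "0 \<le> p0" "transpose A *v p0 = d"
  shows "(INF y\<in>{y. b \<le> A *v y}. ereal (d \<bullet> y))
    = (SUP p\<in>{p. 0 \<le> p \<and> transpose A *v p = d}. ereal (b \<bullet> p))" (is "?L = ?R")
proof (rule antisym)
  show "?R \<le> ?L"
  proof (intro SUP_least INF_greatest)
    fix p y assume "p \<in> {p. 0 \<le> p \<and> transpose A *v p = d}" "y \<in> {y. b \<le> A *v y}"
    then have "b \<le> A *v y" "0 \<le> p" and d: "d = transpose A *v p" by auto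
    then have "0 \<le> (A *v y - b) \<bullet> p"
      by (intro nonneg_inner) (auto simp: less_eq_vec_def)
    then show "ereal (b \<bullet> p) \<le> ereal (d \<bullet> y)"
      by (simp add: d inner_transpose inner_commute[of p] algebra_simps del: transpose_matrix_vector)
  qed
next
  show "?L \<le> ?R"
  proof (rule ccontr)
    assume "\<not> ?L \<le> ?R"
    then have "?R < ?L" by (simp only: not_le)
    from ereal_dense2[OF this] obtain v where v: "?R < ereal v" "ereal v < ?L" by (elim exE conjE)
    \<comment> \<open>\<open>C\<close> pairs each reachable right-hand side with the numbers not
      exceeding a dual value reached there; \<open>G\<close> lists generators. Closedness comes from
      the finiteness of \<open>G\<close>, non-membership of \<open>(d, v)\<close> from
      \<open>C\<close>. The generator \<open>(0, - 1)\<close> forces \<open>\<eta> \<le> 0\<close>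
      below.\<close>
    define G where "G = insert (0, - 1) (range (\<lambda>i. (A $ i, b $ i)))"
    define C where "C = {(transpose A *v p, b \<bullet> p - \<sigma>) | p \<sigma>. 0 \<le> p \<and> 0 \<le> \<sigma>}"
    have "convex_cone C"
      unfolding convex_cone_iff
    proof (intro conjI ballI allI impI)
      show "0 \<in> C"
        unfolding C_def by (intro CollectI exI[of _ 0]) (simp add: zero_prod_def)
    next
      fix x y assume "x \<in> C" "y \<in> C"
      then obtain p \<sigma> p' \<sigma>' where "x = (transpose A *v p, b \<bullet> p - \<sigma>)" "0 \<le> p" "0 \<le> \<sigma>"
        "y = (transpose A *v p', b \<bullet> p' - \<sigma>')" "0 \<le> p'" "0 \<le> \<sigma>'"
        unfolding C_def by blast
      then show "x + y \<in> C"
        unfolding C_def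
        by (intro CollectI exI[of _ "p + p'"] exI[of _ "\<sigma> + \<sigma>'"])
          (auto simp: algebra_simps matrix_vector_right_distrib less_eq_vec_def)
    next
      fix x and a :: real assume "x \<in> C" "0 \<le> a"
      then obtain p \<sigma> where "x = (transpose A *v p, b \<bullet> p - \<sigma>)" "0 \<le> p" "0 \<le> \<sigma>"
        unfolding C_def by blast
      with \<open>0 \<le> a\<close> show "a *\<^sub>R x \<in> C"
        unfolding C_def
        by (intro CollectI exI[of _ "a *\<^sub>R p"] exI[of _ "a * \<sigma>"])
          (auto simp: algebra_simps matrix_vector_mult_scaleR less_eq_vec_def)
    qed
    moreover have "G \<subseteq> C"
    proof -
      have "(0, - 1) \<in> C"
        unfolding C_def by (intro CollectI exI[of _ 0] exI[of _ 1]) auto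
      moreover have "(A $ i, b $ i) \<in> C" for i
      proof -
        have "transpose A *v axis i 1 = A $ i"
          by (simp add: matrix_vector_mul_component vec_eq_iff transpose_def inner_axis)
        then show ?thesis
          unfolding C_def
          by (intro CollectI exI[of _ "axis i 1"] exI[of _ 0])
            (simp_all add: inner_axis nonneg_axis del: transpose_matrix_vector)
      qed
      ultimately show ?thesis unfolding G_def by blast
    qed
    ultimately have hull: "convex_cone hull G \<subseteq> C"
      by (simp add: hull_minimal)
    have "(d, v) \<notin> C"
    proof
      assume "(d, v) \<in> C"
      then obtain p \<sigma> where p: "d = transpose A *v p" "v = b \<bullet> p - \<sigma>" "0 \<le> p" "0 \<le> \<sigma>"
        unfolding C_def by blast
      then have "ereal (b \<bullet> p) \<le> ?R" by (intro SUP_upper) auto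
      from this v(1) have "ereal (b \<bullet> p) < ereal v" by (rule le_less_trans)
      with p show False by simp
    qed
    with hull have notin: "(d, v) \<notin> convex_cone hull G" by blast
    have "closed (convex_cone hull G)"
      unfolding G_def by (intro closed_convex_cone_hull) auto
    then obtain a \<beta> where ab: "a \<bullet> (d, v) < \<beta>" "\<And>x. x \<in> convex_cone hull G \<Longrightarrow> \<beta> < a \<bullet> x"
      using separating_hyperplane_closed_point[OF convex_convex_cone_hull _ notin] by blast
    have "\<beta> < 0" using ab(2)[OF convex_cone_hull_contains_0] by simp
    \<comment> \<open>If \<open>a\<close> were negative on a generator, scaling that generator by
      \<open>\<beta> / (a \<bullet> x)\<close> would give a point of the cone where \<open>a\<close>
      equals \<open>\<beta>\<close>, contrary to the strict separation.\<close>
    have nonneg: "0 \<le> a \<bullet> x" if "x \<in> G" for x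
    proof (rule ccontr)
      assume "\<not> 0 \<le> a \<bullet> x"
      moreover from this have "(\<beta> / (a \<bullet> x)) *\<^sub>R x \<in> convex_cone hull G"
        using that \<open>\<beta> < 0\<close> by (intro convex_cone_hull_mul hull_inc) (auto simp: divide_simps)
      from ab(2)[OF this] show False using \<open>\<not> 0 \<le> a \<bullet> x\<close> by simp
    qed
    obtain y \<eta> where a: "a = (y, \<eta>)" by fastforce
    have rows: "0 \<le> (A *v y) $ i + \<eta> * b $ i" for i
      using nonneg[of "(A $ i, b $ i)"]
      by (auto simp: G_def a matrix_vector_mul_component inner_commute)
    have "\<eta> \<le> 0" using nonneg[of "(0, -1)"] by (auto simp: G_def a)
    have dv: "d \<bullet> y + \<eta> * v < 0" using ab(1) \<open>\<beta> < 0\<close> by (simp add: a inner_commute mult.commute)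
    show False
    proof (cases "\<eta> = 0")
      \<comment> \<open>Now \<open>A *v y\<close> is nonnegative while
        \<open>d \<bullet> y < 0\<close>, which \<open>d = transpose A *v p0\<close> with
        \<open>0 \<le> p0\<close> forbids.\<close>
      case True
      then have "0 \<le> p0 \<bullet> (A *v y)"
        using assms(1) rows by (intro nonneg_inner) (auto simp: less_eq_vec_def)
      then show False using dv True assms(2) by (auto simp: inner_transpose simp del: transpose_matrix_vector)
    next
      \<comment> \<open>Dividing by \<open>- \<eta>\<close> normalises the coefficients of
        \<open>b\<close> and \<open>v\<close>: the point \<open>y'\<close> is primal feasible with
        value below \<open>v\<close>.\<close>
      case False
      with \<open>\<eta> \<le> 0\<close> have "\<eta> < 0" by simp
      define y' where "y' = (- (1 / \<eta>)) *\<^sub>R y"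
      have "b $ i \<le> - ((A *v y) $ i / \<eta>)" for i
        using rows[of i] \<open>\<eta> < 0\<close> by (simp add: field_simps)
      moreover have "A *v y' = (- (1 / \<eta>)) *\<^sub>R (A *v y)"
        unfolding y'_def by (rule matrix_vector_mult_scaleR)
      ultimately have "b \<le> A *v y'" by (simp add: less_eq_vec_def)
      then have "?L \<le> ereal (d \<bullet> y')" by (intro INF_lower) auto
      with v(2) have "ereal v < ereal (d \<bullet> y')" by (rule less_le_trans)
      with dv \<open>\<eta> < 0\<close> show False by (simp add: y'_def field_simps)
    qed
  qed
qed

section \<open>Weak and strong duality for the copositive program\<close>

definition dual_feasible :: "real^'k^'n \<Rightarrow> real^'n \<Rightarrow> real^'n^'m \<Rightarrow> ((real^'k) \<times> (real^'m)) set"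
  where "dual_feasible Q q W = {(\<xi>, p). 0 \<le> \<xi> \<and> 0 \<le> p \<and> Q *v \<xi> + q = transpose W *v p}"

text \<open>At \<open>\<tau> = 1\<close> a dual feasible pair has residual \<open>- q\<close>. The
  terms in \<open>l\<close>, completed by the squared norm of \<open>\<xi>1\<close>, are
  \<open>l\<close> times the squared distance from \<open>\<xi>\<close> to \<open>\<xi>1\<close>,
  which the radius \<open>\<epsilon>\<close> controls.\<close>

lemma cp_weak_duality:
  assumes "copositive (cp_matrix \<delta> \<xi>1 Q Tx hx W l s \<psi> \<phi>)" "0 \<le> l"
    and "(\<xi>, p) \<in> dual_feasible Q q W" "norm (\<xi> - \<xi>1) \<le> \<epsilon>"
  shows "(Tx *v \<xi> + hx) \<bullet> p - \<delta> * (p \<bullet> p)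
    \<le> \<epsilon>\<^sup>2 * l + s + q \<bullet> \<psi> - l * (norm \<xi>1)\<^sup>2 + (\<Sum>j\<in>UNIV. \<phi> $ j * (q $ j)\<^sup>2)"
proof -
  have P: "0 \<le> \<xi>" "0 \<le> p" and eq: "Q *v \<xi> - transpose W *v p = - q"
    using assms(3) by (auto simp: dual_feasible_def algebra_simps eq_neg_iff_add_eq_0
        simp del: transpose_matrix_vector)
  have "0 \<le> (vec 1 :: real^1)" by (simp add: less_eq_vec_def)
  then have "0 \<le> vcat \<xi> (vcat p (vec 1)) \<bullet> (cp_matrix \<delta> \<xi>1 Q Tx hx W l s \<psi> \<phi> *v vcat \<xi> (vcat p (vec 1)))"
    using assms(1) P by (simp add: copositive_def nonneg_vcat)
  then have "0 \<le> l * (\<xi> \<bullet> \<xi> - 2 * (\<xi>1 \<bullet> \<xi>)) + (\<Sum>j\<in>UNIV. \<phi> $ j * (q $ j)\<^sup>2) + \<psi> \<bullet> q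
      - (Tx *v \<xi> + hx) \<bullet> p + \<delta> * (p \<bullet> p) + s"
    unfolding cp_matrix_quadratic_form eq by simp
  moreover have "l * (norm (\<xi> - \<xi>1))\<^sup>2 \<le> l * \<epsilon>\<^sup>2"
    using assms(2,4) by (intro mult_left_mono power_mono) auto
  then have "l * (\<xi> \<bullet> \<xi> - 2 * (\<xi>1 \<bullet> \<xi>)) + l * (norm \<xi>1)\<^sup>2 \<le> l * \<epsilon>\<^sup>2"
    by (simp add: power2_norm_eq_inner inner_diff_left inner_diff_right inner_commute algebra_simps)
  ultimately show ?thesis
    by (simp add: inner_commute mult.commute)
qed

text \<open>The penalty has work to do only where \<open>f\<close> is nonpositive. That set is
  compact, \<open>f\<close> is bounded below on it and \<open>g\<close> is bounded away from 0, so
  one multiplier serves all of its points.\<close>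

lemma compact_penalty:
  fixes f g :: "'a::metric_space \<Rightarrow> real"
  assumes "compact K" "continuous_on K f" "continuous_on K g"
    and "\<And>x. x \<in> K \<Longrightarrow> 0 \<le> g x" "\<And>x. x \<in> K \<Longrightarrow> g x = 0 \<Longrightarrow> 0 < f x"
  shows "\<exists>\<rho>\<ge>0. \<forall>x\<in>K. 0 \<le> f x + \<rho> * g x"
proof -
  define N where "N = {x \<in> K. f x \<le> 0}"
  have "compact N"
    unfolding N_def using continuous_closedin_preimage[OF assms(2), of "{..0}"] assms(1)
    by (auto intro: closedin_compact simp: vimage_def Int_def)
  have cont: "continuous_on N f" "continuous_on N g"
    using assms(2,3) by (auto intro: continuous_on_subset simp: N_def)
  show ?thesis
  proof (cases "N = {}")
    case True
    then show ?thesis by (intro exI[of _ 0]) (force simp: N_def)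
  next
    case False
    obtain a where a: "a \<in> N" "\<And>x. x \<in> N \<Longrightarrow> g a \<le> g x"
      using continuous_attains_inf[OF \<open>compact N\<close> False cont(2)] by blast
    obtain b where b: "b \<in> N" "\<And>x. x \<in> N \<Longrightarrow> f b \<le> f x"
      using continuous_attains_inf[OF \<open>compact N\<close> False cont(1)] by blast
    have "0 < g a" using a(1) assms(4)[of a] assms(5)[of a] by (force simp: N_def)
    have "f b \<le> 0" using b(1) by (simp add: N_def)
    \<comment> \<open>The largest deficit of \<open>f\<close> on \<open>N\<close> divided by the
      least value of \<open>g\<close> there.\<close>
    define \<rho> where "\<rho> = - f b / g a"
    have "0 \<le> \<rho>" using \<open>0 < g a\<close> \<open>f b \<le> 0\<close> by (simp add: \<rho>_def field_simps)
    have "0 \<le> f x + \<rho> * g x" if "x \<in> K" for x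
    proof (cases "x \<in> N")
      case True
      have "- f b = \<rho> * g a" using \<open>0 < g a\<close> by (simp add: \<rho>_def)
      also have "\<dots> \<le> \<rho> * g x" using a(2)[OF True] \<open>0 \<le> \<rho>\<close> by (rule mult_left_mono)
      finally show ?thesis using b(2)[OF True] by simp
    next
      case False
      then show ?thesis using that assms(4)[OF that] \<open>0 \<le> \<rho>\<close> by (simp add: N_def)
    qed
    then show ?thesis using \<open>0 \<le> \<rho>\<close> by blast
  qed
qed

text \<open>With \<open>\<phi> = (\<rho>, \<dots>, \<rho>)\<close> and \<open>\<psi> = - 2 \<rho> q\<close> the quadratic form penalises the violation of the
  homogenised dual constraint by \<open>\<rho> |Q \<xi> - W\<^sup>T p + \<tau> q|\<^sup>2\<close>. The points with \<open>\<tau> = 0\<close> are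
  recession directions of the dual feasible set; \<open>rec\<close> makes the form positive there.\<close>

lemma cp_strong_duality:
  fixes Q :: "real^'k^'n" and W :: "real^'n^'m" and Tx :: "real^'k^'m"
  assumes "0 \<le> \<delta>"
    and rec: "\<And>\<xi> p. 0 \<le> \<xi> \<Longrightarrow> 0 \<le> p \<Longrightarrow> Q *v \<xi> = transpose W *v p \<Longrightarrow> \<xi> = 0 \<and> (0 < \<delta> \<or> p = 0)"
    and v: "\<And>\<xi> p. (\<xi>, p) \<in> dual_feasible Q q W \<Longrightarrow> (Tx *v \<xi> + hx) \<bullet> p - \<delta> * (p \<bullet> p) < v"
  shows "\<exists>s \<psi> \<phi>. copositive (cp_matrix \<delta> \<xi>1 Q Tx hx W 0 s \<psi> \<phi>)
    \<and> s + q \<bullet> \<psi> + (\<Sum>j\<in>UNIV. \<phi> $ j * (q $ j)\<^sup>2) = v"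
proof -
  \<comment> \<open>\<open>f\<close> is the homogenised gap between \<open>v\<close> and the
    penalised dual value, \<open>g\<close> the squared residual of the homogenised dual equation.
    Both are homogeneous of degree two, so the sign of \<open>f + \<rho> g\<close> on the orthant is
    decided on the compact set \<open>K\<close>.\<close>
  define f :: "(real^'k) \<times> (real^'m) \<times> real \<Rightarrow> real"
    where "f = (\<lambda>(\<xi>, p, \<tau>). v * \<tau>\<^sup>2 - (Tx *v \<xi> + \<tau> *\<^sub>R hx) \<bullet> p + \<delta> * (p \<bullet> p))"
  define g :: "(real^'k) \<times> (real^'m) \<times> real \<Rightarrow> real"
    where "g = (\<lambda>(\<xi>, p, \<tau>). (norm (Q *v \<xi> - transpose W *v p + \<tau> *\<^sub>R q))\<^sup>2)"
  define K :: "((real^'k) \<times> (real^'m) \<times> real) set"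
    where "K = sphere 0 1 \<inter> ({0..} \<times> {0..} \<times> {0..})"
  have "compact K"
    unfolding K_def by (intro compact_Int_closed compact_sphere closed_Times) auto
  moreover have "continuous_on K f" "continuous_on K g"
    unfolding f_def g_def case_prod_beta
    by (intro continuous_intros matrix_vector_mult_linear_continuous_on
        continuous_on_compose2[OF matrix_vector_mult_linear_continuous_on[of UNIV]]; simp)+
  moreover have "0 \<le> g z" for z by (simp add: g_def case_prod_beta)
  moreover have "0 < f z" if z: "z \<in> K" "g z = 0" for z
  proof -
    obtain \<xi> p \<tau> where z_eq: "z = (\<xi>, p, \<tau>)" by (metis surj_pair)
    have nn: "0 \<le> \<xi>" "0 \<le> p" "0 \<le> \<tau>" and nz: "(\<xi>, p, \<tau>) \<noteq> 0"
      using z(1) by (auto simp: K_def z_eq)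
    have eq: "Q *v \<xi> - transpose W *v p + \<tau> *\<^sub>R q = 0"
      using z(2) by (simp add: g_def z_eq del: transpose_matrix_vector)
    show ?thesis
    proof (cases "\<tau> = 0")
      \<comment> \<open>Since \<open>z\<close> is nonzero, the coordinate left over is
        \<open>p\<close>, so \<open>\<delta> > 0\<close> and \<open>f z\<close> is
        \<open>\<delta> * (p \<bullet> p)\<close>.\<close>
      case True
      with eq rec[OF nn(1,2)] have "\<xi> = 0" "0 < \<delta> \<or> p = 0"
        by (auto simp del: transpose_matrix_vector)
      with nz True show ?thesis by (auto simp: f_def z_eq zero_prod_def)
    next
      \<comment> \<open>Rescaling to \<open>\<tau> = 1\<close> gives a dual feasible pair; there the
        strict inequality in the hypothesis on \<open>v\<close> makes the gap positive.\<close>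
      case False
      with nn have "0 < \<tau>" by simp
      have "(1 / \<tau>) *\<^sub>R (Q *v \<xi> - transpose W *v p + \<tau> *\<^sub>R q) = 0" by (simp only: eq scaleR_zero_right)
      then have "Q *v ((1 / \<tau>) *\<^sub>R \<xi>) + q = transpose W *v ((1 / \<tau>) *\<^sub>R p)"
        using False by (simp add: algebra_simps matrix_vector_mult_scaleR del: transpose_matrix_vector)
      moreover have "0 \<le> (1 / \<tau>) *\<^sub>R \<xi>" "0 \<le> (1 / \<tau>) *\<^sub>R p"
        using nn by (auto simp: less_eq_vec_def)
      ultimately have "((1 / \<tau>) *\<^sub>R \<xi>, (1 / \<tau>) *\<^sub>R p) \<in> dual_feasible Q q W"
        by (simp add: dual_feasible_def del: transpose_matrix_vector)
      note less = v[OF this]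
      define \<xi>' p' where "\<xi>' = (1 / \<tau>) *\<^sub>R \<xi>" and "p' = (1 / \<tau>) *\<^sub>R p"
      then have "\<xi> = \<tau> *\<^sub>R \<xi>'" "p = \<tau> *\<^sub>R p'" using \<open>0 < \<tau>\<close> by simp_all
      then have "f z = \<tau>\<^sup>2 * (v - ((Tx *v \<xi>' + hx) \<bullet> p' - \<delta> * (p' \<bullet> p')))"
        by (simp add: f_def z_eq matrix_vector_mult_scaleR inner_add_left power2_eq_square algebra_simps)
      then show ?thesis
        using less \<open>0 < \<tau>\<close> by (simp add: \<xi>'_def p'_def)
    qed
  qed
  ultimately obtain \<rho> where \<rho>: "0 \<le> \<rho>" "\<And>z. z \<in> K \<Longrightarrow> 0 \<le> f z + \<rho> * g z"
    using compact_penalty[of K f g] by blast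
  have pos: "0 \<le> f z + \<rho> * g z" if z: "z \<in> {0..} \<times> {0..} \<times> {0..}" for z
  proof (cases "z = 0")
    case True
    then show ?thesis by (simp add: f_def g_def case_prod_beta)
  next
    case False
    define a where "a = 1 / norm z"
    have "0 < a" using False by (simp add: a_def)
    have hom: "f (a *\<^sub>R z) = a\<^sup>2 * f z" "g (a *\<^sub>R z) = a\<^sup>2 * g z"
    proof -
      obtain \<xi> p \<tau> where z_eq: "z = (\<xi>, p, \<tau>)" by (metis surj_pair)
      show "f (a *\<^sub>R z) = a\<^sup>2 * f z"
        by (simp add: f_def z_eq matrix_vector_mult_scaleR inner_add_left power2_eq_square algebra_simps)
      have "Q *v (a *\<^sub>R \<xi>) - transpose W *v (a *\<^sub>R p) + (a * \<tau>) *\<^sub>R q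
          = a *\<^sub>R (Q *v \<xi> - transpose W *v p + \<tau> *\<^sub>R q)"
        by (simp add: matrix_vector_mult_scaleR algebra_simps del: transpose_matrix_vector)
      then show "g (a *\<^sub>R z) = a\<^sup>2 * g z"
        using \<open>0 < a\<close> by (simp add: g_def z_eq power_mult_distrib del: transpose_matrix_vector)
    qed
    have "a *\<^sub>R z \<in> K"
      using z False \<open>0 < a\<close> by (auto simp: K_def a_def less_eq_vec_def)
    from \<rho>(2)[OF this] have "0 \<le> a\<^sup>2 * (f z + \<rho> * g z)"
      by (simp add: hom algebra_simps)
    then show ?thesis using \<open>0 < a\<close> by (simp add: zero_le_mult_iff)
  qed
  \<comment> \<open>These values reproduce the expansion of \<open>\<rho>\<close> times the squared
    residual. In the objective the multiples of \<open>\<rho> * (q \<bullet> q)\<close> have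
    coefficients 1, -2 and 1, so that exactly \<open>v\<close> remains.\<close>
  define s where "s = v + \<rho> * (q \<bullet> q)"
  define \<psi> where "\<psi> = (- 2 * \<rho>) *\<^sub>R q"
  define \<phi> :: "real^'n" where "\<phi> = vec \<rho>"
  have sq: "(\<Sum>j\<in>UNIV. \<phi> $ j * (w $ j)\<^sup>2) = \<rho> * (w \<bullet> w)" for w
    by (simp add: \<phi>_def inner_vec_def sum_distrib_left power2_eq_square)
  have "copositive (cp_matrix \<delta> \<xi>1 Q Tx hx W 0 s \<psi> \<phi>)"
    unfolding copositive_def
  proof (intro conjI allI impI)
    fix z :: "real^('k + ('m + 1))" assume z: "0 \<le> z"
    obtain \<xi> y where y: "z = vcat \<xi> y" by (rule vcat_cases)
    obtain p u where u: "y = vcat p u" by (rule vcat_cases)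
    define \<tau> where "\<tau> = u $ 1"
    have "u = vec \<tau>" by (simp add: vec_eq_iff \<tau>_def)
    then have z_eq: "z = vcat \<xi> (vcat p (vec \<tau>))" by (simp add: y u)
    then have nn: "0 \<le> \<xi>" "0 \<le> p" "0 \<le> (vec \<tau> :: real^1)"
      using z by (auto simp: nonneg_vcat)
    then have "0 \<le> \<tau>" by (simp add: less_eq_vec_def)
    with nn have "0 \<le> f (\<xi>, p, \<tau>) + \<rho> * g (\<xi>, p, \<tau>)" by (intro pos) auto
    also have "\<dots> = z \<bullet> (cp_matrix \<delta> \<xi>1 Q Tx hx W 0 s \<psi> \<phi> *v z)"
      unfolding z_eq cp_matrix_quadratic_form sq f_def g_def prod.case power2_norm_eq_inner
      by (simp add: s_def \<psi>_def inner_add_left inner_add_right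
          inner_diff_left inner_diff_right inner_commute power2_eq_square algebra_simps
          del: transpose_matrix_vector)
    finally show "0 \<le> z \<bullet> (cp_matrix \<delta> \<xi>1 Q Tx hx W 0 s \<psi> \<phi> *v z)" .
  qed (rule transpose_cp_matrix)
  moreover have "s + q \<bullet> \<psi> + (\<Sum>j\<in>UNIV. \<phi> $ j * (q $ j)\<^sup>2) = v"
    by (simp add: s_def \<psi>_def sq)
  ultimately show ?thesis by blast
qed

section \<open>Extended parameters and the robust objective as one supremum\<close>

lemma dual_feasible_ext:
  "(\<xi>, vcat p r) \<in> dual_feasible (ext_Q Q S) (ext_q q t) (ext_W W) \<longleftrightarrow>
    \<xi> \<in> uncertainty_set S t \<and> 0 \<le> p \<and> Q *v \<xi> + q = transpose W *v p \<and> r = t - S *v \<xi>"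
proof -
  \<comment> \<open>The block \<open>- mat 1\<close> makes \<open>r\<close> the slack of
    \<open>S *v \<xi> \<le> t\<close>, so its nonnegativity encodes the uncertainty set.\<close>
  have "transpose (ext_W W) *v vcat p r = vcat (transpose W *v p) (- r)"
    by (simp add: ext_W_def transpose_vcat transpose_hcat hcat_vcat vcat_mult hcat_mult
        transpose_uminus transpose_mat transpose_0 matrix_vector_mult_uminus_left del: transpose_matrix_vector)
  then have "(\<xi>, vcat p r) \<in> dual_feasible (ext_Q Q S) (ext_q q t) (ext_W W) \<longleftrightarrow>
      0 \<le> \<xi> \<and> 0 \<le> p \<and> 0 \<le> r \<and> Q *v \<xi> + q = transpose W *v p \<and> S *v \<xi> - t = - r"
    by (simp add: dual_feasible_def ext_Q_def ext_q_def vcat_mult vcat_add vcat_eq_iff nonneg_vcat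
        del: transpose_matrix_vector)
  moreover have "S *v \<xi> - t = - r \<longleftrightarrow> r = t - S *v \<xi>"
    by (metis add.inverse_inverse minus_diff_eq)
  moreover have "0 \<le> t - S *v \<xi> \<longleftrightarrow> S *v \<xi> \<le> t"
    by (simp add: less_eq_vec_def)
  ultimately show ?thesis
    unfolding uncertainty_set_def by blast
qed

text \<open>Recession directions of the dual feasible set solve the same system with
  \<open>q\<close> and \<open>t\<close> replaced by 0, so \<open>dual_feasible_ext\<close> describes
  them too.\<close>

lemma ext_q_zero: "ext_q 0 0 = 0"
  by (simp add: ext_q_def vec_sum_eq_iff)

lemma inner_ext: "(ext_T A *v \<xi> + ext_h b) \<bullet> vcat p r = (A *v \<xi> + b) \<bullet> p"
  by (simp add: ext_T_def ext_h_def vcat_mult inner_add_left inner_vcat)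

text \<open>The argument \<open>(\<xi>, p)\<close> will range over a set independent of
  \<open>x\<close>, which makes the robust objective a pointwise supremum of real functions of
  \<open>x\<close>.\<close>

definition dual_value ::
    "'x::real_inner \<Rightarrow> ('x \<Rightarrow> real^'k^'m) \<Rightarrow> ('x \<Rightarrow> real^'m) \<Rightarrow> 'x \<Rightarrow> (real^'k) \<times> (real^('m + 'j::finite)) \<Rightarrow> real"
  where "dual_value c T h x = (\<lambda>(\<xi>, p). c \<bullet> x + (ext_T (T x) *v \<xi> + ext_h (h x)) \<bullet> p)"

text \<open>Sufficiently expensive recourse supplies the dual feasible point that
  \<open>lp_duality\<close> asks for at each \<open>\<xi>\<close>. It also keeps the inner suprema
  over nonempty sets, so \<open>c \<bullet> x\<close> can be moved inside them. The nested suprema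
  merge into one once the slack \<open>t - S *v \<xi>\<close> is appended to
  \<open>p\<close>.\<close>

lemma ro_objective_eq_dual:
  assumes ne: "uncertainty_set S t \<noteq> {}"
    and rec: "sufficiently_expensive_recourse Q q W (uncertainty_set S t)"
  shows "ro_objective c Q q T h W (uncertainty_set S t) x
    = (SUP z\<in>dual_feasible (ext_Q Q S) (ext_q q t) (ext_W W). ereal (dual_value c T h x z))"
    (is "_ = ?R")
proof -
  define D where "D \<xi> = {p. 0 \<le> p \<and> transpose W *v p = Q *v \<xi> + q}" for \<xi>
  have D_ne: "D \<xi> \<noteq> {}" if "\<xi> \<in> uncertainty_set S t" for \<xi>
    using rec that by (fastforce simp: sufficiently_expensive_recourse_def D_def simp del: transpose_matrix_vector)
  have rc: "recourse Q q T h W x \<xi> = (SUP p\<in>D \<xi>. ereal ((T x *v \<xi> + h x) \<bullet> p))"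
    if "\<xi> \<in> uncertainty_set S t" for \<xi>
  proof -
    obtain p0 where "p0 \<in> D \<xi>" using D_ne[OF \<open>\<xi> \<in> _\<close>] by blast
    then show ?thesis
      unfolding recourse_def D_def by (intro lp_duality[of p0]) auto
  qed
  have "ro_objective c Q q T h W (uncertainty_set S t) x
      = (SUP \<xi>\<in>uncertainty_set S t. ereal (c \<bullet> x) + recourse Q q T h W x \<xi>)"
    unfolding ro_objective_def using ne by (intro SUP_ereal_add_right[symmetric]) auto
  also have "\<dots> = (SUP \<xi>\<in>uncertainty_set S t. SUP p\<in>D \<xi>. ereal (c \<bullet> x + (T x *v \<xi> + h x) \<bullet> p))"
  proof (intro SUP_cong refl)
    fix \<xi> assume \<xi>: "\<xi> \<in> uncertainty_set S t"
    have "ereal (c \<bullet> x) + (SUP p\<in>D \<xi>. ereal ((T x *v \<xi> + h x) \<bullet> p))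
        = (SUP p\<in>D \<xi>. ereal (c \<bullet> x) + ereal ((T x *v \<xi> + h x) \<bullet> p))"
      using D_ne[OF \<xi>] by (intro SUP_ereal_add_right[symmetric]) auto
    then show "ereal (c \<bullet> x) + recourse Q q T h W x \<xi>
        = (SUP p\<in>D \<xi>. ereal (c \<bullet> x + (T x *v \<xi> + h x) \<bullet> p))"
      by (simp add: rc[OF \<xi>])
  qed
  also have "\<dots> = ?R"
  proof (intro antisym SUP_least)
    fix \<xi> p assume "\<xi> \<in> uncertainty_set S t" "p \<in> D \<xi>"
    then have "(\<xi>, vcat p (t - S *v \<xi>)) \<in> dual_feasible (ext_Q Q S) (ext_q q t) (ext_W W)"
      unfolding dual_feasible_ext D_def by (auto simp del: transpose_matrix_vector)
    then show "ereal (c \<bullet> x + (T x *v \<xi> + h x) \<bullet> p) \<le> ?R"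
      by (rule SUP_upper2) (simp add: dual_value_def inner_ext)
  next
    fix z assume z: "z \<in> dual_feasible (ext_Q Q S) (ext_q q t) (ext_W W)"
    obtain \<xi> y where "z = (\<xi>, y)" by fastforce
    moreover obtain p r where "y = vcat p r" by (rule vcat_cases)
    ultimately have z_eq: "z = (\<xi>, vcat p r)" by simp
    then have "\<xi> \<in> uncertainty_set S t" "p \<in> D \<xi>"
      using z unfolding z_eq dual_feasible_ext D_def by (auto simp del: transpose_matrix_vector)
    then show "ereal (dual_value c T h x z)
        \<le> (SUP \<xi>\<in>uncertainty_set S t. SUP p\<in>D \<xi>. ereal (c \<bullet> x + (T x *v \<xi> + h x) \<bullet> p))"
      by (intro SUP_upper2[of \<xi>] SUP_upper2[of p]) (auto simp: z_eq dual_value_def inner_ext)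
  qed
  finally show ?thesis .
qed

lemma cp_objective_ge_dual:
  assumes "\<And>\<xi>. \<xi> \<in> uncertainty_set S t \<Longrightarrow> norm (\<xi> - \<xi>1) \<le> \<epsilon>"
  shows "(SUP z\<in>dual_feasible (ext_Q Q S) (ext_q q t) (ext_W W).
      ereal (dual_value c T h x z - \<delta> * (snd z \<bullet> snd z))) \<le> cp_objective \<delta> \<epsilon> \<xi>1 c Q q T h W S t x"
  unfolding cp_objective_def
proof (intro SUP_least INF_greatest)
  fix z y assume z: "z \<in> dual_feasible (ext_Q Q S) (ext_q q t) (ext_W W)"
    and y: "y \<in> {(l, s, \<psi>, \<phi>). 0 \<le> l \<and>
          copositive (cp_matrix \<delta> \<xi>1 (ext_Q Q S) (ext_T (T x)) (ext_h (h x)) (ext_W W) l s \<psi> \<phi>)}"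
  obtain \<xi> p' where z': "z = (\<xi>, p')" by fastforce
  moreover obtain p r where "p' = vcat p r" by (rule vcat_cases)
  ultimately have "\<xi> \<in> uncertainty_set S t" using z by (simp add: dual_feasible_ext)
  then have "norm (\<xi> - \<xi>1) \<le> \<epsilon>" by (rule assms)
  obtain l s \<psi> \<phi> where y': "y = (l, s, \<psi>, \<phi>)" by (metis surj_pair)
  then have "0 \<le> l"
    "copositive (cp_matrix \<delta> \<xi>1 (ext_Q Q S) (ext_T (T x)) (ext_h (h x)) (ext_W W) l s \<psi> \<phi>)"
    using y by auto
  from cp_weak_duality[OF this(2,1) z[unfolded z'] \<open>norm (\<xi> - \<xi>1) \<le> \<epsilon>\<close>]
  show "ereal (dual_value c T h x z - \<delta> * (snd z \<bullet> snd z)) \<le> (case y of (l, s, \<psi>, \<phi>) \<Rightarrow>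
      ereal (c \<bullet> x + \<epsilon>\<^sup>2 * l + s + ext_q q t \<bullet> \<psi> - l * (norm \<xi>1)\<^sup>2
        + (\<Sum>j\<in>UNIV. \<phi> $ j * (ext_q q t $ j)\<^sup>2)))"
    by (simp add: y' z' dual_value_def)
qed

section \<open>Recession directions and tightness of the program\<close>

lemma bounded_uncertainty_set_recession:
  assumes "bounded (uncertainty_set S t)" "uncertainty_set S t \<noteq> {}" "0 \<le> \<xi>" "S *v \<xi> \<le> 0"
  shows "\<xi> = 0"
proof (rule ccontr)
  assume "\<xi> \<noteq> 0"
  obtain \<xi>0 where \<xi>0: "\<xi>0 \<in> uncertainty_set S t" using assms(2) by blast
  obtain B where B: "\<And>\<zeta>. \<zeta> \<in> uncertainty_set S t \<Longrightarrow> norm \<zeta> \<le> B"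
    using assms(1) by (auto simp: bounded_iff)
  \<comment> \<open>The displacement along the ray then has norm \<open>B + norm \<xi>0 + 1\<close>,
    one more than the triangle inequality permits for two points of the uncertainty set.\<close>
  define a where "a = (B + norm \<xi>0 + 1) / norm \<xi>"
  have "0 \<le> B" using B[OF \<xi>0] norm_ge_zero order_trans by blast
  then have "0 \<le> a" by (simp add: a_def)
  have "a * (S *v \<xi>) $ i \<le> 0" "0 \<le> a * \<xi> $ k" for i k
    using assms(3,4) \<open>0 \<le> a\<close> by (auto simp: less_eq_vec_def mult_nonneg_nonpos)
  then have "\<xi>0 + a *\<^sub>R \<xi> \<in> uncertainty_set S t"
    using \<xi>0 by (auto simp: uncertainty_set_def less_eq_vec_def matrix_vector_right_distrib
        matrix_vector_mult_scaleR intro: add_nonneg_nonneg order_trans[OF add_mono[of _ _ _ 0]])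
  from B[OF this] have "norm (a *\<^sub>R \<xi>) \<le> B + norm \<xi>0"
    using norm_triangle_ineq4[of "\<xi>0 + a *\<^sub>R \<xi>" \<xi>0] by simp
  then show False using \<open>0 \<le> a\<close> \<open>\<xi> \<noteq> 0\<close> by (simp add: a_def)
qed

text \<open>Pairing with a recourse witness \<open>y\<close> writes 0 as a sum of nonnegative terms
  \<open>p $ i * (W *v y) $ i\<close> whose second factors are positive.\<close>

lemma complete_recourse_trivial_kernel:
  assumes "complete_recourse W" "0 \<le> p" "transpose W *v p = 0"
  shows "p = 0"
proof -
  obtain y where y: "\<And>i. 0 < (W *v y) $ i" using assms(1) by (auto simp: complete_recourse_def)
  have "(\<Sum>i\<in>UNIV. p $ i * (W *v y) $ i) = (transpose W *v p) \<bullet> y"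
    unfolding inner_transpose by (simp add: inner_vec_def)
  also have "\<dots> = 0" by (simp only: assms(3) inner_zero_left)
  finally have "\<forall>i\<in>UNIV. p $ i * (W *v y) $ i = 0"
    using y assms(2) by (subst (asm) sum_nonneg_eq_0_iff) (auto simp: less_eq_vec_def less_imp_le)
  then show ?thesis using y by (auto simp: vec_eq_iff less_le)
qed

text \<open>By strong duality every real \<open>v\<close> above the right-hand side is an objective
  value of the program. The condition on recession directions holds because boundedness of the
  uncertainty set forces \<open>\<xi> = 0\<close>, while either \<open>\<delta> > 0\<close> or
  complete recourse takes care of \<open>p\<close>.\<close>

lemma cp_objective_le_dual:
  assumes "0 < \<delta> \<or> \<delta> = 0 \<and> complete_recourse W"
    and bnd: "bounded (uncertainty_set S t)" "uncertainty_set S t \<noteq> {}"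
  shows "cp_objective \<delta> \<epsilon> \<xi>1 c Q q T h W S t x \<le>
    (SUP z\<in>dual_feasible (ext_Q Q S) (ext_q q t) (ext_W W).
      ereal (dual_value c T h x z - \<delta> * (snd z \<bullet> snd z)))" (is "?L \<le> ?R")
proof (rule ccontr)
  assume "\<not> ?L \<le> ?R"
  then have "?R < ?L" by (simp only: not_le)
  from ereal_dense2[OF this] obtain v where v: "?R < ereal v" "ereal v < ?L" by (elim exE conjE)
  have "\<exists>s \<psi> \<phi>. copositive (cp_matrix \<delta> \<xi>1 (ext_Q Q S) (ext_T (T x)) (ext_h (h x)) (ext_W W) 0 s \<psi> \<phi>)
    \<and> s + ext_q q t \<bullet> \<psi> + (\<Sum>j\<in>UNIV. \<phi> $ j * (ext_q q t $ j)\<^sup>2) = v - c \<bullet> x"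
  proof (rule cp_strong_duality)
    show "0 \<le> \<delta>" using assms(1) by auto
  next
    fix \<xi> p assume nn: "0 \<le> \<xi>" "0 \<le> p" and eq: "ext_Q Q S *v \<xi> = transpose (ext_W W) *v p"
    obtain p1 r where p: "p = vcat p1 r" by (rule vcat_cases)
    \<comment> \<open>Read as dual feasibility for zero data, the homogeneous equation shows that
      \<open>\<xi>\<close> is a recession direction of the uncertainty set.\<close>
    have "(\<xi>, vcat p1 r) \<in> dual_feasible (ext_Q Q S) (ext_q 0 0) (ext_W W)"
      using nn eq by (simp add: dual_feasible_def ext_q_zero p
          del: transpose_matrix_vector)
    then have mem: "\<xi> \<in> uncertainty_set S 0" "0 \<le> p1" "Q *v \<xi> = transpose W *v p1" "r = - (S *v \<xi>)"
      unfolding dual_feasible_ext by (simp_all del: transpose_matrix_vector)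
    then have "\<xi> = 0"
      by (intro bounded_uncertainty_set_recession[OF bnd]) (auto simp: uncertainty_set_def)
    moreover have "p = 0" if "complete_recourse W"
    proof -
      have "p1 = 0"
        using mem \<open>\<xi> = 0\<close> by (intro complete_recourse_trivial_kernel[OF that])
          (simp_all del: transpose_matrix_vector)
      then show ?thesis using mem \<open>\<xi> = 0\<close> by (simp add: p vec_sum_eq_iff)
    qed
    ultimately show "\<xi> = 0 \<and> (0 < \<delta> \<or> p = 0)" using assms(1) by auto
  next
    fix \<xi> p assume "(\<xi>, p) \<in> dual_feasible (ext_Q Q S) (ext_q q t) (ext_W W)"
    then have "ereal (dual_value c T h x (\<xi>, p) - \<delta> * (snd (\<xi>, p) \<bullet> snd (\<xi>, p))) \<le> ?R"
      by (rule SUP_upper)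
    from this v(1) have "ereal (dual_value c T h x (\<xi>, p) - \<delta> * (snd (\<xi>, p) \<bullet> snd (\<xi>, p))) < ereal v"
      by (rule le_less_trans)
    then show "(ext_T (T x) *v \<xi> + ext_h (h x)) \<bullet> p - \<delta> * (p \<bullet> p) < v - c \<bullet> x"
      by (simp add: dual_value_def)
  qed
  then obtain s \<psi> \<phi> where
    cop: "copositive (cp_matrix \<delta> \<xi>1 (ext_Q Q S) (ext_T (T x)) (ext_h (h x)) (ext_W W) 0 s \<psi> \<phi>)"
    and val: "s + ext_q q t \<bullet> \<psi> + (\<Sum>j\<in>UNIV. \<phi> $ j * (ext_q q t $ j)\<^sup>2) = v - c \<bullet> x"
    by blast
  \<comment> \<open>With \<open>l = 0\<close> the terms in \<open>\<epsilon>\<close> and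
    \<open>\<xi>1\<close> vanish from the objective.\<close>
  have "?L \<le> ereal v"
    unfolding cp_objective_def using cop val by (intro INF_lower2[of "(0, s, \<psi>, \<phi>)"]) auto
  with v(2) show False by simp
qed

section \<open>Continuity in the first-stage decision\<close>

lemma continuous_dual_value:
  fixes T :: "'x::euclidean_space \<Rightarrow> real^'k^'m"
  assumes "affine_map T" "affine_map h"
  shows "continuous_on UNIV (\<lambda>x. dual_value c T h x z)"
proof -
  have aff: "continuous_on UNIV f" if "affine_map f" for f :: "'x \<Rightarrow> 'b::real_normed_vector"
  proof -
    from that obtain L b where "linear L" "f = (\<lambda>x. L x + b)" by (auto simp: affine_map_def)
    moreover from \<open>linear L\<close> have "bounded_linear L" by (rule linear_conv_bounded_linear[THEN iffD1])
    ultimately show ?thesis by (simp add: continuous_on_add linear_continuous_on)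
  qed
  obtain \<xi> p' where z: "z = (\<xi>, p')" by fastforce
  obtain p r where p: "p' = vcat p r" by (rule vcat_cases)
  show ?thesis
    unfolding z p dual_value_def prod.case inner_ext
    unfolding inner_vec_def[of "_ + _"] matrix_vector_mult_def
    using aff[OF assms(1)] aff[OF assms(2)] by (auto intro!: continuous_intros simp: inner_real_def)
qed

section \<open>Vanishing penalties over a compact set\<close>

context
  fixes X :: "'x::metric_space set" and P :: "'z set" and F :: "'x \<Rightarrow> 'z \<Rightarrow> real" and N :: "'z \<Rightarrow> real"
  assumes X: "compact X"
    and F: "\<And>z. z \<in> P \<Longrightarrow> continuous_on UNIV (\<lambda>x. F x z)"
    and N: "\<And>z. z \<in> P \<Longrightarrow> 0 \<le> N z"
begin

lemma penalised_SUP_le: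
  "0 \<le> \<delta> \<Longrightarrow> (SUP z\<in>P. ereal (F x z - \<delta> * N z)) \<le> (SUP z\<in>P. ereal (F x z))"
  using N by (intro SUP_mono) (auto intro!: bexI)

text \<open>A one-sided Dini argument. Below a level \<open>b\<close> under the limit, each point of
  \<open>X\<close> has an index and a penalty weight that still exceed \<open>b\<close> on a
  neighbourhood; finitely many of these cover \<open>X\<close>, and smaller weights only raise the
  values. The upper bound is monotonicity.\<close>

lemma penalised_INF_SUP_tendsto:
  "((\<lambda>\<delta>. INF x\<in>X. SUP z\<in>P. ereal (F x z - \<delta> * N z)) \<longlongrightarrow> (INF x\<in>X. SUP z\<in>P. ereal (F x z)))
    (at_right 0)" (is "(?f \<longlongrightarrow> ?l) _")
proof (rule order_tendstoI)
  fix a assume "a < ?l"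
  from ereal_dense2[OF this] obtain b where b: "a < ereal b" "ereal b < ?l" by (elim exE conjE)
  have "\<exists>z d. z \<in> P \<and> 0 < d \<and> b < F x z - d * N z" if "x \<in> X" for x
  proof -
    have "ereal b < (SUP z\<in>P. ereal (F x z))"
      using b(2) INF_lower[OF that, of "\<lambda>x. SUP z\<in>P. ereal (F x z)"] by (rule less_le_trans)
    then obtain z where z: "z \<in> P" "b < F x z" by (auto simp: less_SUP_iff)
    \<comment> \<open>This weight leaves \<open>F x z - d * N z = b + d\<close>; adding 1 to
      \<open>N z\<close> keeps the denominator positive.\<close>
    define d where "d = (F x z - b) / (N z + 1)"
    have "0 < d" using z N[OF z(1)] by (auto simp: d_def intro!: divide_pos_pos)
    moreover have "d * (N z + 1) = F x z - b" using N[OF z(1)] by (simp add: d_def)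
    then have "F x z - d * N z = b + d" by (simp add: algebra_simps)
    ultimately show ?thesis using z(1) by (intro exI[of _ z] exI[of _ d]) auto
  qed
  then obtain z d where zd: "\<And>x. x \<in> X \<Longrightarrow> z x \<in> P \<and> 0 < d x \<and> b < F x (z x) - d x * N (z x)"
    by metis
  obtain C where C: "C \<subseteq> X" "finite C" "X \<subseteq> (\<Union>c\<in>C. {y. b < F y (z c) - d c * N (z c)})"
  proof (rule compactE_image[OF X, of X "\<lambda>c. {y. b < F y (z c) - d c * N (z c)}"])
    show "open {y. b < F y (z c) - d c * N (z c)}" if "c \<in> X" for c
      using F zd[OF that] by (intro open_Collect_less continuous_intros) auto
  qed (use zd in auto)
  \<comment> \<open>The extra element 1 keeps the minimum defined when \<open>C\<close>, and with it
    \<open>X\<close>, is empty.\<close>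
  define \<delta>0 where "\<delta>0 = Min (insert 1 (d ` C))"
  have "0 < \<delta>0" using C zd by (auto simp: \<delta>0_def)
  have "a < ?f \<delta>" if "0 < \<delta>" "\<delta> < \<delta>0" for \<delta>
  proof -
    have "ereal b \<le> ?f \<delta>"
    proof (rule INF_greatest)
      fix y assume "y \<in> X"
      then obtain c where c: "c \<in> C" "b < F y (z c) - d c * N (z c)" using C by blast
      have "\<delta>0 \<le> d c" using C(2) c(1) by (auto simp: \<delta>0_def)
      then have "\<delta> * N (z c) \<le> d c * N (z c)"
        using that zd N c(1) C(1) by (intro mult_right_mono) auto
      then show "ereal b \<le> (SUP z\<in>P. ereal (F y z - \<delta> * N z))"
        using c zd C(1) by (intro SUP_upper2[of "z c"]) auto
    qed
    with b(1) show ?thesis by (rule less_le_trans)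
  qed
  then show "\<forall>\<^sub>F \<delta> in at_right 0. a < ?f \<delta>"
    unfolding eventually_at_right_field using \<open>0 < \<delta>0\<close> by blast
next
  fix a assume "?l < a"
  have "?f \<delta> \<le> ?l" if "0 < \<delta>" for \<delta>
    using penalised_SUP_le[of \<delta>] that by (intro INF_mono) (auto intro!: bexI)
  with \<open>?l < a\<close> have "?f \<delta> < a" if "0 < \<delta>" for \<delta>
    using that by (meson le_less_trans)
  then show "\<forall>\<^sub>F \<delta> in at_right 0. ?f \<delta> < a"
    by (auto simp: eventually_at_right_field intro!: exI[of _ 1])
qed

text \<open>If some \<open>y\<close> were strictly better than \<open>x'\<close>, a single index
  \<open>z\<close> would witness a level \<open>a\<close> between the two values at
  \<open>x'\<close>. By continuity it does so at some \<open>x n\<close>, penalty included, and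
  minimality of \<open>x n\<close> carries this lower bound \<open>a\<close> over to
  \<open>y\<close>.\<close>

lemma penalised_cluster_point_is_arg_min:
  assumes \<delta>: "\<And>n. 0 < \<delta> n" "\<delta> \<longlonglongrightarrow> 0"
    and min: "\<And>n. is_arg_min (\<lambda>x. SUP z\<in>P. ereal (F x z - \<delta> n * N z)) (\<lambda>x. x \<in> X) (x n)"
    and x: "x \<longlonglongrightarrow> x'"
  shows "is_arg_min (\<lambda>x. SUP z\<in>P. ereal (F x z)) (\<lambda>x. x \<in> X) x'"
proof -
  have "x' \<in> X"
    using min by (intro closed_sequentially[OF compact_imp_closed[OF X] _ x]) (auto simp: is_arg_min_def)
  moreover have False if "y \<in> X" "(SUP z\<in>P. ereal (F y z)) < (SUP z\<in>P. ereal (F x' z))" for y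
  proof -
    from ereal_dense2[OF that(2)] obtain a where
      a: "(SUP z\<in>P. ereal (F y z)) < ereal a" "ereal a < (SUP z\<in>P. ereal (F x' z))"
      by (elim exE conjE)
    obtain z where z: "z \<in> P" "a < F x' z" using a(2) by (auto simp: less_SUP_iff)
    have "(\<lambda>n. F (x n) z - \<delta> n * N z) \<longlonglongrightarrow> F x' z - 0 * N z"
      using F[OF z(1)] x \<delta>(2)
      by (intro tendsto_intros continuous_on_tendsto_compose[where f = "\<lambda>x. F x z" and s = UNIV]) auto
    then have "\<forall>\<^sub>F n in sequentially. a < F (x n) z - \<delta> n * N z"
      using z(2) by (intro order_tendstoD(1)) auto
    then obtain n where n: "a < F (x n) z - \<delta> n * N z"
      by (auto simp: eventually_sequentially)
    then have "ereal a \<le> (SUP z\<in>P. ereal (F (x n) z - \<delta> n * N z))"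
      using z(1) by (intro SUP_upper2[of z]) auto
    also have "\<dots> \<le> (SUP z\<in>P. ereal (F y z - \<delta> n * N z))"
      using min[of n] that(1) by (auto simp: is_arg_min_def not_less)
    also have "\<dots> \<le> (SUP z\<in>P. ereal (F y z))"
      using \<delta>(1)[of n] by (intro penalised_SUP_le) auto
    finally show False using a(1) by simp
  qed
  ultimately show ?thesis unfolding is_arg_min_def by blast
qed

end

section \<open>Assembling the four statements\<close>

theorem corollary1:
  fixes c :: "real^'n1" and X :: "(real^'n1) set"
    and Q :: "real^'k^'n2" and q :: "real^'n2"
    and T :: "real^'n1 \<Rightarrow> real^'k^'m" and h :: "real^'n1 \<Rightarrow> real^'m"
    and W :: "real^'n2^'m"
    and S :: "real^'k^'j" and t :: "real^'j"
    and \<epsilon> :: real and \<xi>1 :: "real^'k"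
  assumes "affine_map T" and "affine_map h"
    and "uncertainty_set S t \<noteq> {}" and "bounded (uncertainty_set S t)"
    and "sufficiently_expensive_recourse Q q W (uncertainty_set S t)"
    and "0 \<le> \<epsilon>" and "\<xi>1 \<in> uncertainty_set S t"
    and "\<And>\<xi>. \<xi> \<in> uncertainty_set S t \<Longrightarrow> norm (\<xi> - \<xi>1) \<le> \<epsilon>"
  shows
    "let ro = ro_objective c Q q T h W (uncertainty_set S t);
         cp = (\<lambda>\<delta>. cp_objective \<delta> \<epsilon> \<xi>1 c Q q T h W S t)
     in (complete_recourse W \<longrightarrow> (\<forall>x\<in>X. cp 0 x = ro x))
      \<and> (\<not> complete_recourse W \<longrightarrow> (INF x\<in>X. ro x) \<le> (INF x\<in>X. cp 0 x))
      \<and> (\<forall>\<delta>>0. (INF x\<in>X. cp \<delta> x) \<le> (INF x\<in>X. ro x))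
      \<and> (compact X \<longrightarrow>
          ((\<lambda>\<delta>. INF x\<in>X. cp \<delta> x) \<longlongrightarrow> (INF x\<in>X. ro x)) (at_right 0)
          \<and> (\<forall>(\<delta> :: nat \<Rightarrow> real) (x :: nat \<Rightarrow> real^'n1) r x'.
                (\<forall>n. 0 < \<delta> n) \<and> \<delta> \<longlonglongrightarrow> 0
                \<and> (\<forall>n. is_arg_min (cp (\<delta> n)) (\<lambda>x. x \<in> X) (x n))
                \<and> strict_mono r \<and> (x \<circ> r) \<longlonglongrightarrow> x'
                \<longrightarrow> is_arg_min ro (\<lambda>x. x \<in> X) x'))"
proof -
  define P where "P = dual_feasible (ext_Q Q S) (ext_q q t) (ext_W W)"
  define F :: "real^'n1 \<Rightarrow> (real^'k) \<times> (real^('m + 'j)) \<Rightarrow> real" where "F = dual_value c T h"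
  define N :: "(real^'k) \<times> (real^('m + 'j)) \<Rightarrow> real" where "N = (\<lambda>z. snd z \<bullet> snd z)"
  define ro where "ro = ro_objective c Q q T h W (uncertainty_set S t)"
  define cp where "cp = (\<lambda>\<delta>. cp_objective \<delta> \<epsilon> \<xi>1 c Q q T h W S t)"
  have ro: "ro = (\<lambda>x. SUP z\<in>P. ereal (F x z))"
    unfolding ro_def P_def F_def by (intro ext ro_objective_eq_dual assms)
  have ge: "(SUP z\<in>P. ereal (F x z - \<delta> * N z)) \<le> cp \<delta> x" for \<delta> x
    unfolding cp_def P_def F_def N_def by (intro cp_objective_ge_dual assms)
  have le: "cp \<delta> x \<le> (SUP z\<in>P. ereal (F x z - \<delta> * N z))"
    if "0 < \<delta> \<or> \<delta> = 0 \<and> complete_recourse W" for \<delta> x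
    unfolding cp_def P_def F_def N_def by (intro cp_objective_le_dual assms that)
  have cp: "cp \<delta> = (\<lambda>x. SUP z\<in>P. ereal (F x z - \<delta> * N z))" if "0 < \<delta>" for \<delta>
    using ge le that by (intro ext antisym) auto
  have F: "continuous_on UNIV (\<lambda>x. F x z)" and N: "0 \<le> N z" for z
    unfolding F_def N_def by (intro continuous_dual_value assms) simp
  have 1: "cp 0 x = ro x" if "complete_recourse W" for x
    using ge[of x 0] le[of 0 x] that by (simp add: ro)
  \<comment> \<open>At \<open>\<delta> = 0\<close> the penalty disappears, and the weak inequality
    \<open>ge\<close> already bounds \<open>ro\<close> by \<open>cp 0\<close>.\<close>
  have 2: "(INF x\<in>X. ro x) \<le> (INF x\<in>X. cp 0 x)"
    using ge[of _ 0] by (intro INF_mono) (auto simp: ro intro!: bexI)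
  have 3: "(INF x\<in>X. cp \<delta> x) \<le> (INF x\<in>X. ro x)" if "0 < \<delta>" for \<delta>
    unfolding cp[OF that] ro using that N
    by (intro INF_mono) (auto intro!: bexI SUP_mono)
  have 4: "((\<lambda>\<delta>. INF x\<in>X. cp \<delta> x) \<longlongrightarrow> (INF x\<in>X. ro x)) (at_right 0)" if "compact X"
  proof -
    \<comment> \<open>The supremum formula \<open>cp\<close> holds for all
      \<open>\<delta> > 0\<close>, hence eventually in the right-sided filter.\<close>
    have "\<forall>\<^sub>F \<delta> in at_right 0. (INF x\<in>X. cp \<delta> x) = (INF x\<in>X. SUP z\<in>P. ereal (F x z - \<delta> * N z))"
      by (auto simp: eventually_at_right_field cp intro!: exI[of _ 1])
    then show ?thesis
      unfolding ro using penalised_INF_SUP_tendsto[OF that F N] by (simp only: tendsto_cong)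
  qed
  have 5: "is_arg_min ro (\<lambda>x. x \<in> X) x'"
    if "compact X" "\<And>n. 0 < \<delta> n" "\<delta> \<longlonglongrightarrow> 0"
      "\<And>n. is_arg_min (cp (\<delta> n)) (\<lambda>x. x \<in> X) (x n)" "strict_mono r" "(x \<circ> r) \<longlonglongrightarrow> x'"
    for \<delta> :: "nat \<Rightarrow> real" and x r x'
    unfolding ro
  \<comment> \<open>A cluster point is a limit along \<open>r\<close>, so both sequences are
    reindexed; the weights still tend to 0.\<close>
  proof (rule penalised_cluster_point_is_arg_min[where \<delta> = "\<delta> \<circ> r" and x = "x \<circ> r" and N = N, OF that(1) F N])
    show "(\<delta> \<circ> r) \<longlonglongrightarrow> 0" using that(3,5) by (rule LIMSEQ_subseq_LIMSEQ)
    show "is_arg_min (\<lambda>x. SUP z\<in>P. ereal (F x z - (\<delta> \<circ> r) n * N z)) (\<lambda>x. x \<in> X) ((x \<circ> r) n)" for n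
      using that(4)[of "r n"] unfolding cp[OF that(2)] by simp
  qed (use that in auto)
  show ?thesis
    unfolding Let_def ro_def[symmetric] cp_def[symmetric]
    using 1 2 3 4 5 by blast
qed

end
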